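(* Let $0<r<1$ and $q(z_1,z_2)=z_1z_2-\frac{r}{1+r^2}$. Then the zero set $Z(q)\subset\mathbb{C}^2$ of $q$ is a minimal closed von Neumann set for $\kappa(C_\beta)$.
   Context: All operators are bounded linear maps on complex Hilbert spaces. $C_\beta$ is the class of all invertible operators; for an invertible operator $T$, $\kappa(T)=\left(\frac{T}{\sqrt{1+r^2}},\frac{rT^{-1}}{\sqrt{1+r^2}}\right)$, and $\kappa(C_\beta)=\{\kappa(T):T\in C_\beta\}$. A set $Y\subseteq\mathbb{C}^n$ is a von Neumann set for a commuting $n$-tuple $\underline{T}$ if its Taylor joint spectrum satisfies $\sigma_T(\underline{T})\subseteq Y$ and $\|f(\underline{T})\|\le\sup_{\xi\in Y}|f(\xi)|$ (possibly $+\infty$) for every rational function $f=p/g$ with $p,g\in\mathbb{C}[z_1,\dots,z_n]$ and $g$ having no zeros in $Y$, where $f(\underline{T})=p(\underline{T})g(\underline{T})^{-1}$. A closed set $Y\subset\mathbb{C}^n$ is a minimal closed von Neumann set for a class $\mathcal{S}$ of commuting $n$-tuples if $Y$ is a von Neumann set for each member of $\mathcal{S}$ and for every proper closed subset $Y_1$ of $Y$ there is $\underline{S}\in\mathcal{S}$ such that $Y_1$ is not a von Neumann set for $\underline{S}$. *)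

theory Defs
  imports
    "HOL-Analysis.Analysis"
    "HOL-Library.Poly_Mapping"
    "HOL-Algebra.Module"
    "HOL-Algebra.Algebraic_Closure_Type"
begin

section \<open>Complex Hilbert spaces and bounded operators\<close>

text \<open>
  A class of operators ranges over all Hilbert spaces, so Hilbert spaces are carrier-based
  structures and not types.  The fields \<open>mult\<close> and \<open>one\<close> inherited from the ring record are
  unused, as always for modules in HOL-Algebra.
\<close>

record 'a hilbert = "(complex, 'a) module" +
  cinner :: "'a \<Rightarrow> 'a \<Rightarrow> complex"

definition hnorm :: "('a, 'b) hilbert_scheme \<Rightarrow> 'a \<Rightarrow> real" where
  "hnorm H x = sqrt (Re (cinner H x x))"

locale complex_hilbert_space =
  module "ring_of_type_algebra :: complex ring" H for H :: "('a, 'b) hilbert_scheme" (structure) +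
  assumes cinner_add_left:
      "\<lbrakk>x \<in> carrier H; y \<in> carrier H; z \<in> carrier H\<rbrakk> \<Longrightarrow>
        cinner H (x \<oplus> y) z = cinner H x z + cinner H y z"
    and cinner_smult_left:
      "\<lbrakk>x \<in> carrier H; y \<in> carrier H\<rbrakk> \<Longrightarrow> cinner H (c \<odot> x) y = c * cinner H x y"
    and cinner_commute:
      "\<lbrakk>x \<in> carrier H; y \<in> carrier H\<rbrakk> \<Longrightarrow> cinner H y x = cnj (cinner H x y)"
    and cinner_pos:
      "\<lbrakk>x \<in> carrier H; x \<noteq> \<zero>\<rbrakk> \<Longrightarrow> 0 < Re (cinner H x x)"
    and cauchy_complete:
      "\<lbrakk>\<And>n. u n \<in> carrier H;
        \<And>\<epsilon>. \<epsilon> > 0 \<Longrightarrow> \<exists>N. \<forall>m\<ge>N. \<forall>n\<ge>N. hnorm H (u m \<ominus> u n) < \<epsilon>\<rbrakk> \<Longrightarrow>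
        \<exists>x\<in>carrier H. (\<lambda>n::nat. hnorm H (u n \<ominus> x)) \<longlonglongrightarrow> 0"

text \<open>Operators are functions on the ambient type; only their values on the carrier matter.\<close>

definition bounded_operator :: "('a, 'b) hilbert_scheme \<Rightarrow> ('a \<Rightarrow> 'a) \<Rightarrow> bool" where
  "bounded_operator H A \<longleftrightarrow>
     A \<in> carrier H \<rightarrow> carrier H \<and>
     (\<forall>x\<in>carrier H. \<forall>y\<in>carrier H. A (x \<oplus>\<^bsub>H\<^esub> y) = A x \<oplus>\<^bsub>H\<^esub> A y) \<and>
     (\<forall>c. \<forall>x\<in>carrier H. A (c \<odot>\<^bsub>H\<^esub> x) = c \<odot>\<^bsub>H\<^esub> A x) \<and>
     (\<exists>C. \<forall>x\<in>carrier H. hnorm H (A x) \<le> C * hnorm H x)"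

definition invertible_operator :: "('a, 'b) hilbert_scheme \<Rightarrow> ('a \<Rightarrow> 'a) \<Rightarrow> bool" where
  "invertible_operator H A \<longleftrightarrow>
     bounded_operator H A \<and>
     (\<exists>B. bounded_operator H B \<and> (\<forall>x\<in>carrier H. B (A x) = x \<and> A (B x) = x))"

abbreviation op_inverse :: "('a, 'b) hilbert_scheme \<Rightarrow> ('a \<Rightarrow> 'a) \<Rightarrow> 'a \<Rightarrow> 'a" where
  "op_inverse H A \<equiv> inv_into (carrier H) A"

definition op_norm :: "('a, 'b) hilbert_scheme \<Rightarrow> ('a \<Rightarrow> 'a) \<Rightarrow> ennreal" where
  "op_norm H A = (SUP x\<in>{x \<in> carrier H. hnorm H x \<le> 1}. ennreal (hnorm H (A x)))"

text \<open>An \<open>n\<close>-tuple is indexed by a finite linearly ordered type \<open>'n\<close> with \<open>n\<close> elements.\<close>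

definition commuting_tuple ::
  "('a, 'b) hilbert_scheme \<Rightarrow> ('n \<Rightarrow> 'a \<Rightarrow> 'a) \<Rightarrow> bool" where
  "commuting_tuple H T \<longleftrightarrow>
     (\<forall>i. bounded_operator H (T i)) \<and>
     (\<forall>i j. \<forall>x\<in>carrier H. T i (T j x) = T j (T i x))"


section \<open>Taylor joint spectrum\<close>

text \<open>
  The Koszul complex of \<open>T\<close> lives on \<open>H \<otimes> \<Lambda>(\<complex>\<^sup>n)\<close>.  An element \<open>\<Sum>\<^sub>S x\<^sub>S \<otimes> e\<^sub>S\<close>, where
  \<open>e\<^sub>S = e\<^bsub>s1\<^esub> \<and> \<dots> \<and> e\<^bsub>sk\<^esub>\<close> for \<open>S = {s1 < \<dots> < sk}\<close>, is represented by the function \<open>S \<mapsto> x\<^sub>S\<close>,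
  and the boundary map is \<open>x \<otimes> \<omega> \<mapsto> \<Sum>\<^sub>i T\<^sub>i x \<otimes> (e\<^sub>i \<and> \<omega>)\<close>.  As this map is homogeneous of
  degree one, the complex is exact in every degree iff its total kernel and range coincide.
\<close>

definition koszul_space :: "('a, 'b) hilbert_scheme \<Rightarrow> ('n set \<Rightarrow> 'a) set" where
  "koszul_space H = UNIV \<rightarrow> carrier H"

definition koszul_boundary ::
  "('a, 'b) hilbert_scheme \<Rightarrow> ('n::{finite,linorder} \<Rightarrow> 'a \<Rightarrow> 'a) \<Rightarrow> ('n set \<Rightarrow> 'a) \<Rightarrow> 'n set \<Rightarrow> 'a"
  where
  "koszul_boundary H T x S =
     (\<Oplus>\<^bsub>H\<^esub>i\<in>S. (-1) ^ card {j\<in>S. j < i} \<odot>\<^bsub>H\<^esub> T i (x (S - {i})))"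

definition koszul_exact ::
  "('a, 'b) hilbert_scheme \<Rightarrow> ('n::{finite,linorder} \<Rightarrow> 'a \<Rightarrow> 'a) \<Rightarrow> bool" where
  "koszul_exact H T \<longleftrightarrow>
     {x \<in> koszul_space H. \<forall>S. koszul_boundary H T x S = \<zero>\<^bsub>H\<^esub>} =
     koszul_boundary H T ` koszul_space H"

definition taylor_spectrum ::
  "('a, 'b) hilbert_scheme \<Rightarrow> ('n \<Rightarrow> 'a \<Rightarrow> 'a) \<Rightarrow> (complex^('n::{finite,linorder})) set" where
  "taylor_spectrum H T = {\<mu>. \<not> koszul_exact H (\<lambda>i x. T i x \<ominus>\<^bsub>H\<^esub> (\<mu> $ i) \<odot>\<^bsub>H\<^esub> x)}"


section \<open>Polynomials in several variables\<close>

type_synonym 'n cpoly = "('n \<Rightarrow>\<^sub>0 nat) \<Rightarrow>\<^sub>0 complex"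

definition pvar :: "'n \<Rightarrow> 'n cpoly" where
  "pvar i = Poly_Mapping.single (Poly_Mapping.single i 1) 1"

definition pconst :: "complex \<Rightarrow> 'n cpoly" where
  "pconst c = Poly_Mapping.single 0 c"

definition peval :: "'n::finite cpoly \<Rightarrow> complex^'n \<Rightarrow> complex" where
  "peval p z = (\<Sum>m\<in>Poly_Mapping.keys p.
     Poly_Mapping.lookup p m * (\<Prod>i\<in>UNIV. (z $ i) ^ Poly_Mapping.lookup m i))"

definition zero_set :: "'n::finite cpoly \<Rightarrow> (complex^'n) set" where
  "zero_set p = {z. peval p z = 0}"

text \<open>For commuting \<open>T\<close> the order of the factors in a monomial is irrelevant.\<close>

definition op_monomial ::
  "('n::{finite,linorder} \<Rightarrow> 'a \<Rightarrow> 'a) \<Rightarrow> ('n \<Rightarrow>\<^sub>0 nat) \<Rightarrow> 'a \<Rightarrow> 'a" where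
  "op_monomial T m =
     foldr (\<lambda>i A. (T i ^^ Poly_Mapping.lookup m i) \<circ> A) (sorted_list_of_set UNIV) id"

definition op_peval ::
  "('a, 'b) hilbert_scheme \<Rightarrow> 'n::{finite,linorder} cpoly \<Rightarrow> ('n \<Rightarrow> 'a \<Rightarrow> 'a) \<Rightarrow> 'a \<Rightarrow> 'a" where
  "op_peval H p T x = (\<Oplus>\<^bsub>H\<^esub>m\<in>Poly_Mapping.keys p.
     Poly_Mapping.lookup p m \<odot>\<^bsub>H\<^esub> op_monomial T m x)"


section \<open>Von Neumann sets\<close>

definition von_Neumann_set ::
  "(complex^('n::{finite,linorder})) set \<Rightarrow> ('a, 'b) hilbert_scheme \<Rightarrow> ('n \<Rightarrow> 'a \<Rightarrow> 'a) \<Rightarrow> bool" where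
  "von_Neumann_set Y H T \<longleftrightarrow>
     taylor_spectrum H T \<subseteq> Y \<and>
     (\<forall>p g. (\<forall>\<xi>\<in>Y. peval g \<xi> \<noteq> 0) \<longrightarrow>
        op_norm H (op_peval H p T \<circ> op_inverse H (op_peval H g T))
          \<le> (SUP \<xi>\<in>Y. ennreal (cmod (peval p \<xi> / peval g \<xi>))))"

text \<open>A member of a class of tuples is a tuple together with the space it acts on.\<close>

definition minimal_closed_von_Neumann_set ::
  "(complex^('n::{finite,linorder})) set \<Rightarrow> ('a hilbert \<times> ('n \<Rightarrow> 'a \<Rightarrow> 'a)) set \<Rightarrow> bool" where
  "minimal_closed_von_Neumann_set Y \<S> \<longleftrightarrow>
     (\<forall>(H, T)\<in>\<S>. complex_hilbert_space H \<and> commuting_tuple H T) \<and>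
     closed Y \<and>
     (\<forall>(H, T)\<in>\<S>. von_Neumann_set Y H T) \<and>
     (\<forall>Y1. closed Y1 \<and> Y1 \<subset> Y \<longrightarrow> (\<exists>(H, T)\<in>\<S>. \<not> von_Neumann_set Y1 H T))"


section \<open>Invertible operators and the map kappa\<close>

text \<open>
  All invertible operators on all Hilbert spaces with carrier inside the type \<open>'a\<close>, which plays
  the role of a universe.  It contains a nonzero Hilbert space iff \<open>\<complex>\<close> injects into \<open>'a\<close>; this size
  condition has to accompany every statement that needs a nonzero member of the class.
\<close>

definition C_beta :: "('a hilbert \<times> ('a \<Rightarrow> 'a)) set" where
  "C_beta = {(H, T). complex_hilbert_space H \<and> invertible_operator H T}"

text \<open>The index type \<open>2\<close> has the elements \<open>1\<close> and \<open>2\<close>, the latter being \<open>0\<close> modulo two.\<close>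

definition kappa :: "real \<Rightarrow> 'a hilbert \<times> ('a \<Rightarrow> 'a) \<Rightarrow> 'a hilbert \<times> (2 \<Rightarrow> 'a \<Rightarrow> 'a)" where
  "kappa r = (\<lambda>(H, T). (H, \<lambda>i.
     if i = 1 then (\<lambda>x. complex_of_real (1 / sqrt (1 + r\<^sup>2)) \<odot>\<^bsub>H\<^esub> T x)
     else (\<lambda>x. complex_of_real (r / sqrt (1 + r\<^sup>2)) \<odot>\<^bsub>H\<^esub> op_inverse H T x)))"

end

theory Submission
  imports Defs
begin

text \<open>
  On the hyperbola \<open>z\<^sub>1 z\<^sub>2 = c\<close>, parametrised by \<open>z \<noteq> 0\<close> as \<open>(z, c / z)\<close>, every polynomial becomes a
  Laurent polynomial in \<open>z\<close>.  A denominator without zeros there is a monomial \<open>a z\<^sup>k\<close>, so a rational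
  function that is bounded on the hyperbola is a bounded Laurent polynomial, hence a constant \<open>\<gamma>\<close>.
  The same identity of Laurent polynomials holds for a pair of operators with \<open>T\<^sub>1 T\<^sub>2 = T\<^sub>2 T\<^sub>1 = c\<close>, so
  \<open>f(T) = \<gamma>\<close> and von Neumann's inequality is trivial; for unbounded \<open>f\<close> its right-hand side is
  infinite.  Off the hyperbola,
  \<open>(T\<^sub>1 - \<mu>\<^sub>1) T\<^sub>2 + \<mu>\<^sub>1 (T\<^sub>2 - \<mu>\<^sub>2) = c - \<mu>\<^sub>1 \<mu>\<^sub>2\<close> is an invertible scalar, which makes the Koszul complex
  exact.  For minimality, every point of the hyperbola is a joint eigenvalue of \<open>\<kappa>(T)\<close> for a scalar
  operator \<open>T\<close> on a one-dimensional space.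
\<close>

section \<open>Polynomials on a hyperbola\<close>

no_notation fps_nth (infixl \<open>$\<close> 75)

lemma poly_split_order_0:
  fixes p :: "complex poly"
  assumes "p \<noteq> 0"
  obtains q where "p = [:0, 1:] ^ Polynomial.order 0 p * q" and "poly q 0 \<noteq> 0"
  using order_decomp[OF assms, of 0] by (auto simp: poly_eq_0_iff_dvd)

text \<open>Once the zero at the origin is split off, the remaining factor has no zeros at all and
  is constant by the fundamental theorem of algebra.\<close>

lemma monom_if_zero_free_off_0:
  fixes p :: "complex poly"
  assumes zf: "\<And>z. z \<noteq> 0 \<Longrightarrow> poly p z \<noteq> 0"
  obtains a k where "a \<noteq> 0" and "p = Polynomial.monom a k"
proof -
  have "p \<noteq> 0" using zf[of 1] by auto
  then obtain q where q: "p = [:0, 1:] ^ Polynomial.order 0 p * q" "poly q 0 \<noteq> 0"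
    by (rule poly_split_order_0)
  have "poly q z \<noteq> 0" for z
    using zf[of z] q(2) arg_cong[OF q(1), of "\<lambda>p. poly p z"] by (cases "z = 0") auto
  then have "Polynomial.degree q = 0"
    using fundamental_theorem_of_algebra[of q] constant_degree[of q] by auto
  then obtain b where b: "q = [:b:]" by (rule degree_eq_zeroE)
  have "p = Polynomial.monom b (Polynomial.order 0 p)"
    by (subst q(1)) (simp add: b monom_altdef)
  moreover have "b \<noteq> 0" using q b by auto
  ultimately show thesis using that by blast
qed

text \<open>The bound near \<open>0\<close> forces a zero of order at least \<open>k\<close>; after
  division by \<open>z ^ k\<close> the bound near infinity forces the quotient to be
  constant.\<close>

lemma monom_if_bounded_by_power:
  fixes p :: "complex poly"
  assumes bd: "\<And>z. z \<noteq> 0 \<Longrightarrow> cmod (poly p z) \<le> M * cmod z ^ k"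
  obtains b where "p = Polynomial.monom b k"
proof (cases "p = 0")
  case True
  then show thesis using that[of 0] by simp
next
  case False
  define m where "m = Polynomial.order 0 p"
  obtain q where q: "p = [:0, 1:] ^ m * q" "poly q 0 \<noteq> 0"
    unfolding m_def using False by (rule poly_split_order_0)
  have pz: "poly p z = z ^ m * poly q z" for z by (subst q(1)) simp
  have "k \<le> m"
  proof (rule ccontr)
    assume "\<not> k \<le> m"
    \<comment> \<open>The surplus power \<open>Suc j\<close> makes the bound on \<open>q\<close>
      tend to \<open>0\<close> at the origin, against \<open>poly q 0 \<noteq> 0\<close>.\<close>
    then obtain j where j: "k = m + Suc j" by (metis add_Suc_right less_imp_Suc_add not_le)
    have le: "cmod (poly q z) \<le> M * cmod z ^ Suc j" if "z \<noteq> 0" for z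
    proof -
      have "cmod z ^ m * cmod (poly q z) \<le> cmod z ^ m * (M * cmod z ^ Suc j)"
        using bd[OF that] by (simp add: pz j norm_mult norm_power power_add mult_ac)
      then show ?thesis using that by (subst (asm) mult_le_cancel_left_pos) simp_all
    qed
    have 1: "(\<lambda>z. cmod (poly q z)) \<midarrow>0\<rightarrow> cmod (poly q 0)"
      by (intro tendsto_intros)
    have 2: "(\<lambda>z. M * cmod z ^ Suc j) \<midarrow>(0::complex)\<rightarrow> M * cmod 0 ^ Suc j"
      by (intro tendsto_intros)
    have "cmod (poly q 0) \<le> M * cmod 0 ^ Suc j"
      by (rule tendsto_le[OF _ 2 1])
        (simp, rule eventually_mono[OF eventually_neq_at_within], rule le)
    then show False using q(2) by simp
  qed
  then obtain j where j: "m = k + j" using le_Suc_ex by blast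
  define s where "s = [:0, 1:] ^ j * q"
  have s: "p = [:0, 1:] ^ k * s" by (subst q(1)) (simp add: s_def j power_add mult_ac)
  have sz: "poly p z = z ^ k * poly s z" for z by (subst s) simp
  have le: "cmod (poly s z) \<le> M" if "z \<noteq> 0" for z
  proof -
    have "cmod z ^ k * cmod (poly s z) \<le> cmod z ^ k * M"
      using bd[OF that] by (simp add: sz norm_mult norm_power mult_ac)
    then show ?thesis using that by (subst (asm) mult_le_cancel_left_pos) simp_all
  qed
  have "Polynomial.degree s = 0"
  proof (rule ccontr)
    assume "Polynomial.degree s \<noteq> 0"
    moreover obtain a s' where "s = pCons a s'" by (cases s)
    ultimately obtain R where R: "\<forall>z. R \<le> cmod z \<longrightarrow> M + 1 \<le> cmod (poly s z)"
      using poly_infinity[of s' "M + 1" a] by (auto split: if_splits)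
    \<comment> \<open>The real point \<open>max 1 R\<close> has modulus at least \<open>R\<close>
      and is nonzero, as \<open>le\<close> demands.\<close>
    have "M + 1 \<le> cmod (poly s (of_real (max 1 R)))" using R by (simp add: max_def)
    moreover have "of_real (max 1 R) \<noteq> (0 :: complex)" by (simp add: max_def)
    ultimately show False using le[of "of_real (max 1 R)"] by linarith
  qed
  then obtain b where b: "s = [:b:]" by (rule degree_eq_zeroE)
  have "p = Polynomial.monom b k" by (subst s) (simp add: b monom_altdef)
  then show thesis by (rule that)
qed

section \<open>The two-element index type\<close>

lemma UNIV_two: "(UNIV :: 2 set) = {1, 2}"
  using exhaust_2 by auto

text \<open>The numeral \<open>2\<close> of type \<open>2\<close> is \<open>0\<close>, hence the smaller of the two indices.\<close>

lemma less_two: "(2 :: 2) < 1" "\<not> (1 :: 2) < 2"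
proof -
  have 2: "(2 :: 2) = 0" using exhaust_2[of 0] by simp
  have "(0 :: 2) < 1" by (simp add: less_bit0_def bit0.Rep_0 bit0.Rep_1)
  then show "(2 :: 2) < 1" "\<not> (1 :: 2) < 2"
    unfolding 2 by simp_all
qed

lemma sorted_list_two: "sorted_list_of_set (UNIV :: 2 set) = [2, 1]"
  by (rule sorted_list_of_set.idem_if_sorted_distinct[THEN trans[rotated], symmetric])
    (use less_two in \<open>auto simp: UNIV_two insert_commute\<close>)

text \<open>Since \<open>2\<close> is the smaller index, the power of \<open>T 2\<close> stands
  outermost.\<close>

lemma op_monomial_two:
  "op_monomial T m x =
     (T (2 :: 2) ^^ Poly_Mapping.lookup m 2) ((T 1 ^^ Poly_Mapping.lookup m 1) x)"
  by (simp add: op_monomial_def sorted_list_two)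

section \<open>Evaluation of polynomials on the hyperbola\<close>

lemma peval_superset:
  assumes "finite S" and "Poly_Mapping.keys p \<subseteq> S"
  shows "peval p z =
    (\<Sum>m\<in>S. Poly_Mapping.lookup p m * (\<Prod>i\<in>UNIV. (z $ i) ^ Poly_Mapping.lookup m i))"
  unfolding peval_def using assms
  by (intro sum.mono_neutral_left) (auto simp: in_keys_iff)

lemma zero_set_hyperbola:
  "zero_set (pvar 1 * pvar 2 - pconst c :: 2 cpoly) = {z. z $ 1 * z $ 2 = c}"
proof -
  define m :: "2 \<Rightarrow>\<^sub>0 nat" where "m = Poly_Mapping.single 1 1 + Poly_Mapping.single 2 1"
  have m: "Poly_Mapping.lookup m 1 = 1" "Poly_Mapping.lookup m 2 = 1"
    by (simp_all add: m_def lookup_add lookup_single)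
  then have m0: "m \<noteq> 0" by auto
  have q: "(pvar 1 * pvar 2 - pconst c :: 2 cpoly) =
      Poly_Mapping.single m 1 - Poly_Mapping.single 0 c"
    by (simp add: pvar_def pconst_def mult_single m_def)
  \<comment> \<open>Only an inclusion is claimed, because the key \<open>0\<close> disappears when
    \<open>c = 0\<close>; \<open>peval_superset\<close> is made for this.\<close>
  have "Poly_Mapping.keys (Poly_Mapping.single m 1 - Poly_Mapping.single 0 c) \<subseteq> {m, 0}"
    by (auto simp: in_keys_iff lookup_minus lookup_single when_def split: if_splits)
  then have "peval (pvar 1 * pvar 2 - pconst c) z = z $ 1 * z $ 2 - c" for z :: "complex^2"
    unfolding q using m m0
    by (subst peval_superset[where S = "{m, 0}"])
      (auto simp: lookup_minus lookup_single UNIV_two)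
  then show ?thesis by (simp add: zero_set_def)
qed

text \<open>
  The substitution \<open>z\<^sub>2 = c / z\<^sub>1\<close> multiplied by \<open>z\<^sub>1\<^sup>N\<close>.  The natural-number subtraction is exact only
  if \<open>N\<close> bounds the exponents of \<open>z\<^sub>2\<close> in \<open>p\<close>.
\<close>

definition hyperbola_poly :: "complex \<Rightarrow> nat \<Rightarrow> 2 cpoly \<Rightarrow> complex poly" where
  "hyperbola_poly c N p = (\<Sum>m\<in>Poly_Mapping.keys p.
     Polynomial.monom (Poly_Mapping.lookup p m * c ^ Poly_Mapping.lookup m 2)
       (Poly_Mapping.lookup m 1 + N - Poly_Mapping.lookup m 2))"

text \<open>Monomial by monomial: with \<open>c = z $ 1 * z $ 2\<close>, the factor
  \<open>c ^ k\<close> restores the \<open>k\<close> powers of \<open>z $ 1\<close> that were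
  subtracted from the exponent and contributes the power of \<open>z $ 2\<close>.\<close>

lemma poly_hyperbola_poly:
  fixes z :: "complex^2"
  assumes N: "\<And>m. m \<in> Poly_Mapping.keys p \<Longrightarrow> Poly_Mapping.lookup m 2 \<le> N"
    and z: "z $ 1 * z $ 2 = c"
  shows "poly (hyperbola_poly c N p) (z $ 1) = (z $ 1) ^ N * peval p z"
proof -
  have "c ^ k * (z $ 1) ^ (l + N - k) = (z $ 1) ^ N * ((z $ 1) ^ l * (z $ 2) ^ k)"
    if "k \<le> N" for k l
  proof -
    from that obtain j where "N = k + j" using le_Suc_ex by blast
    then show ?thesis by (simp add: z[symmetric] power_mult_distrib power_add)
  qed
  with N show ?thesis
    by (simp add: hyperbola_poly_def peval_def poly_sum poly_monom sum_distrib_left UNIV_two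
        mult.assoc mult.left_commute[of "_ ^ N"])
qed

section \<open>Linear operators and polynomials in one operator\<close>

lemma ring_of_type_algebra_simps:
  "carrier (ring_of_type_algebra :: 'b::ring_1 ring) = UNIV"
  "x \<oplus>\<^bsub>ring_of_type_algebra\<^esub> y = x + y"
  "x \<otimes>\<^bsub>ring_of_type_algebra\<^esub> y = x * y"
  "\<zero>\<^bsub>ring_of_type_algebra\<^esub> = (0 :: 'b)"
  "\<one>\<^bsub>ring_of_type_algebra\<^esub> = (1 :: 'b)"
  by (simp_all add: ring_of_type_algebra_def)

text \<open>The algebraic half of \<open>bounded_operator\<close>, split off for the identities
  between powers, polynomials and Koszul maps.\<close>

definition linear_operator :: "('a, 'b) hilbert_scheme \<Rightarrow> ('a \<Rightarrow> 'a) \<Rightarrow> bool" where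
  "linear_operator H A \<longleftrightarrow>
     A \<in> carrier H \<rightarrow> carrier H \<and>
     (\<forall>x\<in>carrier H. \<forall>y\<in>carrier H. A (x \<oplus>\<^bsub>H\<^esub> y) = A x \<oplus>\<^bsub>H\<^esub> A y) \<and>
     (\<forall>c. \<forall>x\<in>carrier H. A (c \<odot>\<^bsub>H\<^esub> x) = c \<odot>\<^bsub>H\<^esub> A x)"

lemma bounded_operator_iff_linear:
  "bounded_operator H A \<longleftrightarrow>
     linear_operator H A \<and> (\<exists>C. \<forall>x\<in>carrier H. hnorm H (A x) \<le> C * hnorm H x)"
  by (auto simp: bounded_operator_def linear_operator_def)

lemma linear_operatorD:
  assumes "linear_operator H A"
  shows "x \<in> carrier H \<Longrightarrow> A x \<in> carrier H"
    and "\<lbrakk>x \<in> carrier H; y \<in> carrier H\<rbrakk> \<Longrightarrow> A (x \<oplus>\<^bsub>H\<^esub> y) = A x \<oplus>\<^bsub>H\<^esub> A y"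
    and "x \<in> carrier H \<Longrightarrow> A (c \<odot>\<^bsub>H\<^esub> x) = c \<odot>\<^bsub>H\<^esub> A x"
  using assms by (auto simp: linear_operator_def)

lemma linear_operator_funpow:
  assumes "linear_operator H A"
  shows "linear_operator H (A ^^ n)"
  using assms by (induction n) (auto simp: linear_operator_def Pi_iff)

context complex_hilbert_space
begin

lemma scale_closed [simp, intro]: "x \<in> carrier H \<Longrightarrow> c \<odot> x \<in> carrier H"
  by (simp add: ring_of_type_algebra_simps)

lemma scale_add_left: "x \<in> carrier H \<Longrightarrow> (a + b) \<odot> x = a \<odot> x \<oplus> b \<odot> x"
  using smult_l_distr[of a b x] by (simp add: ring_of_type_algebra_simps)

lemma scale_add_right:
  "\<lbrakk>x \<in> carrier H; y \<in> carrier H\<rbrakk> \<Longrightarrow> c \<odot> (x \<oplus> y) = c \<odot> x \<oplus> c \<odot> y"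
  using smult_r_distr[of c x y] by (simp add: ring_of_type_algebra_simps)

lemma scale_scale: "x \<in> carrier H \<Longrightarrow> a \<odot> (b \<odot> x) = (a * b) \<odot> x"
  using smult_assoc1[of a b x] by (simp add: ring_of_type_algebra_simps)

lemma scale_one [simp]: "x \<in> carrier H \<Longrightarrow> 1 \<odot> x = x"
  using smult_one[of x] by (simp add: ring_of_type_algebra_simps)

lemma scale_zero_left [simp]: "x \<in> carrier H \<Longrightarrow> 0 \<odot> x = \<zero>"
  using smult_l_null[of x] by (simp add: ring_of_type_algebra_simps)

lemma scale_zero_right [simp]: "c \<odot> \<zero> = \<zero>"
  using smult_r_null[of c] by (simp add: ring_of_type_algebra_simps)

lemma minus_eq_scale: "x \<in> carrier H \<Longrightarrow> \<ominus> x = (-1) \<odot> x"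
  using scale_add_left[of x "-1" 1] by (simp add: minus_equality)

text \<open>Turns differences into sums, so that linear combinations can be normalised by the rules
  for addition and scaling alone.\<close>

lemma diff_eq_scale:
  "\<lbrakk>x \<in> carrier H; y \<in> carrier H\<rbrakk> \<Longrightarrow> x \<ominus> y = x \<oplus> (-1) \<odot> y"
  by (simp add: a_minus_def minus_eq_scale)

lemma cinner_smult_right:
  "\<lbrakk>x \<in> carrier H; y \<in> carrier H\<rbrakk> \<Longrightarrow> cinner H x (c \<odot> y) = cnj c * cinner H x y"
  using cinner_commute[of "c \<odot> y" x] cinner_commute[of y x] by (simp add: cinner_smult_left)

lemma hnorm_scale: "x \<in> carrier H \<Longrightarrow> hnorm H (c \<odot> x) = cmod c * hnorm H x"
proof -
  assume x: "x \<in> carrier H"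
  have "cinner H (c \<odot> x) (c \<odot> x) = (c * cnj c) * cinner H x x"
    using x by (simp add: cinner_smult_left cinner_smult_right)
  then have "Re (cinner H (c \<odot> x) (c \<odot> x)) = (cmod c)\<^sup>2 * Re (cinner H x x)"
    unfolding complex_norm_square[symmetric] by (simp del: of_real_power)
  then show ?thesis by (simp add: hnorm_def real_sqrt_mult)
qed

lemma linear_operator_finsum:
  assumes A: "linear_operator H A" and "finite F" and "f \<in> F \<rightarrow> carrier H"
  shows "A (\<Oplus>i\<in>F. f i) = (\<Oplus>i\<in>F. A (f i))"
  using assms(2,3)
proof (induction F rule: finite_induct)
  case empty
  \<comment> \<open>Linearity has no clause for \<open>\<zero>\<close>; homogeneity with the factor
    \<open>0\<close> yields \<open>A \<zero> = \<zero>\<close>.\<close>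
  have "A (0 \<odot> \<zero>) = 0 \<odot> A \<zero>" using linear_operatorD(3)[OF A] by blast
  then show ?case using linear_operatorD(1)[OF A, of \<zero>] by simp
next
  case (insert i F)
  then have "f i \<in> carrier H" "f \<in> F \<rightarrow> carrier H" by auto
  moreover from this have "A (f i) \<in> carrier H" "(\<lambda>i. A (f i)) \<in> F \<rightarrow> carrier H"
    using linear_operatorD(1)[OF A] by auto
  ultimately show ?case using insert by (simp add: linear_operatorD(2)[OF A])
qed

text \<open>The vector \<open>p(A) x\<close> of the polynomial functional calculus.\<close>

definition poly_apply :: "('a \<Rightarrow> 'a) \<Rightarrow> 'a \<Rightarrow> complex poly \<Rightarrow> 'a" where
  "poly_apply A x p = (\<Oplus>i\<in>{..Polynomial.degree p}. Polynomial.coeff p i \<odot> (A ^^ i) x)"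

context
  fixes A :: "'a \<Rightarrow> 'a" and x :: 'a
  assumes A: "linear_operator H A" and x: "x \<in> carrier H"
begin

lemma funpow_closed: "(A ^^ n) x \<in> carrier H"
  using linear_operatorD(1)[OF linear_operator_funpow[OF A] x] .

text \<open>Coefficients beyond the degree vanish, so polynomials of different degrees can be summed
  over one common range.\<close>

lemma poly_apply_bound:
  assumes "Polynomial.degree p \<le> n"
  shows "poly_apply A x p = (\<Oplus>i\<in>{..n}. Polynomial.coeff p i \<odot> (A ^^ i) x)"
  unfolding poly_apply_def using assms
  by (intro add.finprod_mono_neutral_cong_left) (auto simp: funpow_closed coeff_eq_0)

lemma poly_apply_closed: "poly_apply A x p \<in> carrier H"
  unfolding poly_apply_def by (intro finsum_closed) (auto simp: funpow_closed)

lemma poly_apply_add: "poly_apply A x (p + q) = poly_apply A x p \<oplus> poly_apply A x q"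
proof -
  define n where "n = max (Polynomial.degree p) (Polynomial.degree q)"
  have "Polynomial.degree p \<le> n" "Polynomial.degree q \<le> n" "Polynomial.degree (p + q) \<le> n"
    by (auto simp: n_def degree_add_le)
  then show ?thesis
    by (simp add: poly_apply_bound scale_add_left finsum_addf Pi_iff funpow_closed)
qed

lemma poly_apply_monom: "poly_apply A x (Polynomial.monom c n) = c \<odot> (A ^^ n) x"
proof -
  \<comment> \<open>The range ends at \<open>n\<close> and not at the degree, which is
    \<open>0\<close> when \<open>c = 0\<close>.\<close>
  have "poly_apply A x (Polynomial.monom c n) = (\<Oplus>i\<in>{..n}. Polynomial.coeff (Polynomial.monom c n) i \<odot> (A ^^ i) x)"
    by (intro poly_apply_bound degree_monom_le)
  also have "\<dots> = (\<Oplus>i\<in>{..n}. if n = i then c \<odot> (A ^^ i) x else \<zero>)"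
    by (intro finsum_cong') (auto simp: funpow_closed)
  also have "\<dots> = c \<odot> (A ^^ n) x"
    by (intro add.finprod_singleton) (auto simp: funpow_closed)
  finally show ?thesis .
qed

lemma poly_apply_sum:
  assumes "finite F"
  shows "poly_apply A x (\<Sum>i\<in>F. p i) = (\<Oplus>i\<in>F. poly_apply A x (p i))"
  using assms
proof (induction F rule: finite_induct)
  case empty
  then show ?case using poly_apply_monom[of 0 0] by (simp add: funpow_closed x)
next
  case (insert i F)
  then show ?case by (simp add: poly_apply_add poly_apply_closed)
qed

end

section \<open>Shifts and multiples of operators\<close>

lemma diff_eq_zero_iff [simp]:
  "\<lbrakk>x \<in> carrier H; y \<in> carrier H\<rbrakk> \<Longrightarrow> x \<ominus> y = \<zero> \<longleftrightarrow> x = y"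
  unfolding a_minus_def by (metis a_inv_closed minus_equality minus_minus r_neg)

lemma diff_self [simp]: "x \<in> carrier H \<Longrightarrow> x \<ominus> x = \<zero>"
  by simp

lemma linear_operator_scale:
  "linear_operator H A \<Longrightarrow> linear_operator H (\<lambda>x. c \<odot> A x)"
  by (auto simp: linear_operator_def scale_add_right scale_scale mult.commute Pi_iff)

lemma linear_operator_diff_scale:
  assumes A: "linear_operator H A"
  shows "linear_operator H (\<lambda>x. A x \<ominus> c \<odot> x)"
  unfolding linear_operator_def
proof (intro conjI ballI allI funcsetI)
  fix x y assume "x \<in> carrier H" "y \<in> carrier H"
  then show "A (x \<oplus> y) \<ominus> c \<odot> (x \<oplus> y) = A x \<ominus> c \<odot> x \<oplus> (A y \<ominus> c \<odot> y)"
    by (simp add: diff_eq_scale linear_operatorD[OF A] scale_add_right a_ac)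
qed (auto simp: diff_eq_scale linear_operatorD[OF A] scale_add_right scale_scale mult.commute)

lemma diff_scale_commute:
  assumes A: "linear_operator H A" and B: "linear_operator H B"
    and "A (B x) = B (A x)" and "x \<in> carrier H"
  shows "A (B x) \<ominus> c \<odot> B x = B (A x \<ominus> c \<odot> x)"
  using assms(3,4) by (simp add: diff_eq_scale linear_operatorD[OF A] linear_operatorD[OF B])

lemma bounded_operator_scale:
  assumes "bounded_operator H A"
  shows "bounded_operator H (\<lambda>x. c \<odot> A x)"
proof -
  have A: "linear_operator H A" using assms by (simp add: bounded_operator_iff_linear)
  obtain C where "\<forall>x\<in>carrier H. hnorm H (A x) \<le> C * hnorm H x"
    using assms by (auto simp: bounded_operator_iff_linear)
  then have "\<forall>x\<in>carrier H. hnorm H (c \<odot> A x) \<le> (cmod c * C) * hnorm H x"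
    by (simp add: hnorm_scale linear_operatorD[OF A] mult_left_mono mult.assoc)
  with A show ?thesis
    by (auto simp: bounded_operator_iff_linear intro: linear_operator_scale)
qed

lemma bounded_operator_id: "bounded_operator H (\<lambda>x. x)"
  by (auto simp: bounded_operator_def intro: exI[of _ 1])

subsection \<open>The Koszul complex of a pair\<close>

text \<open>The minus sign falls on the summand for index \<open>1\<close>, because \<open>2\<close>
  is the smaller index and so \<open>1\<close> has one predecessor.\<close>

lemma koszul_boundary_two:
  fixes D :: "2 \<Rightarrow> 'a \<Rightarrow> 'a"
  assumes D: "\<And>i. linear_operator H (D i)" and x: "x \<in> koszul_space H"
  shows "koszul_boundary H D x {} = \<zero>"
    and "koszul_boundary H D x {i} = D i (x {})"
    and "koszul_boundary H D x UNIV = D 2 (x {1}) \<ominus> D 1 (x {2})"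
proof -
  have c: "D i (x S) \<in> carrier H" for i S
    using linear_operatorD(1)[OF D] x by (auto simp: koszul_space_def)
  show "koszul_boundary H D x {} = \<zero>"
    by (simp add: koszul_boundary_def)
  have "{j. j = i \<and> j < i} = {}" by auto
  with c show "koszul_boundary H D x {i} = D i (x {})"
    by (simp (no_asm_simp) add: koszul_boundary_def)
  have "{j. (j = 1 \<or> j = 2) \<and> j < 1} = {2 :: 2}"
    "{j. (j = 1 \<or> j = 2) \<and> j < 2} = ({} :: 2 set)"
    "{1, 2} - {1} = {2 :: 2}" "{1, 2} - {2} = {1 :: 2}"
    using less_two by auto
  with c show "koszul_boundary H D x UNIV = D 2 (x {1}) \<ominus> D 1 (x {2})"
    by (simp (no_asm_simp) add: koszul_boundary_def UNIV_two diff_eq_scale a_comm)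
qed

lemma set_two_cases:
  fixes S :: "2 set"
  obtains "S = {}" | i where "S = {i}" | "S = UNIV"
proof -
  have "S \<subseteq> {1, 2}" by (simp flip: UNIV_two)
  then have "S = {} \<or> S = {1} \<or> S = {2} \<or> S = UNIV" unfolding UNIV_two by blast
  then show thesis using that by blast
qed

text \<open>The identity \<open>U\<^sub>1 D\<^sub>1 + U\<^sub>2 D\<^sub>2 = 1\<close> makes contraction with \<open>U\<close> a homotopy from \<open>1\<close> to \<open>0\<close>.\<close>

lemma koszul_exact_two:
  fixes D U :: "2 \<Rightarrow> 'a \<Rightarrow> 'a"
  assumes D: "\<And>i. linear_operator H (D i)" and U: "\<And>i. linear_operator H (U i)"
    and DD: "\<And>x. x \<in> carrier H \<Longrightarrow> D 1 (D 2 x) = D 2 (D 1 x)"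
    and DU: "\<And>i j x. x \<in> carrier H \<Longrightarrow> D i (U j x) = U j (D i x)"
    and UD: "\<And>x. x \<in> carrier H \<Longrightarrow> U 1 (D 1 x) \<oplus> U 2 (D 2 x) = x"
  shows "koszul_exact H D"
proof -
  note lin = linear_operatorD[OF D] linear_operatorD[OF U]
  note bd = koszul_boundary_two[of D, OF D]
  have zero: "D i \<zero> = \<zero>" "U i \<zero> = \<zero>" for i
    using lin(3)[of \<zero> i 0] lin(1)[of \<zero> i] lin(6)[of \<zero> i 0] lin(4)[of \<zero> i] by simp_all
  have mem: "x S \<in> carrier H" if "x \<in> koszul_space H" for x and S :: "2 set"
    using that by (auto simp: koszul_space_def)
  have closed: "koszul_boundary H D x \<in> koszul_space H" if x: "x \<in> koszul_space H" for x
    unfolding koszul_space_def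
  proof
    fix S :: "2 set"
    show "koszul_boundary H D x S \<in> carrier H"
      by (cases S rule: set_two_cases) (use bd[OF x] lin mem[OF x] in auto)
  qed
  \<comment> \<open>The range lies in the kernel; in the top degree this is the commutation of
    \<open>D 1\<close> and \<open>D 2\<close>.\<close>
  have complex: "koszul_boundary H D (koszul_boundary H D x) S = \<zero>"
    if x: "x \<in> koszul_space H" for x S
    by (cases S rule: set_two_cases)
      (simp_all add: bd[OF x] bd[OF closed[OF x]] lin mem[OF x] zero DD)
  have exact: "x \<in> koszul_boundary H D ` koszul_space H"
    if x: "x \<in> koszul_space H" and ker: "\<And>S. koszul_boundary H D x S = \<zero>" for x
  proof -
    have k0: "D i (x {}) = \<zero>" for i
      using ker[of "{i}"] bd[OF x] by simp
    have "D 2 (x {1}) \<ominus> D 1 (x {2}) = \<zero>"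
      using ker[of UNIV] bd[OF x] by simp
    then have k1: "D 2 (x {1}) = D 1 (x {2})"
      using lin mem[OF x] by simp
    have x0: "x {} = \<zero>"
      using UD[of "x {}"] mem[OF x] by (simp add: k0 zero)
    \<comment> \<open>The contraction of \<open>x\<close> with \<open>U\<close>. As
      \<open>2 < 1\<close>, the top form is \<open>e_2\<close> wedge \<open>e_1\<close>, whose
      contraction is \<open>U 2\<close> on \<open>e_1\<close> minus \<open>U 1\<close> on
      \<open>e_2\<close>.\<close>
    define y where "y = (\<lambda>S :: 2 set.
      if S = {} then U 1 (x {1}) \<oplus> U 2 (x {2})
      else if S = {1} then U 2 (x UNIV)
      else if S = {2} then (-1) \<odot> U 1 (x UNIV)
      else \<zero>)"
    have y: "y \<in> koszul_space H"
      using lin mem[OF x] by (auto simp: koszul_space_def y_def)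
    have ys: "y {} = U 1 (x {1}) \<oplus> U 2 (x {2})" "y {1} = U 2 (x UNIV)"
        "y {2} = (-1) \<odot> U 1 (x UNIV)"
      by (auto simp: y_def)
    \<comment> \<open>The cycle condition \<open>k1\<close> replaces \<open>D 1 (x {2})\<close> by
      \<open>D 2 (x {1})\<close>, after which \<open>UD\<close> applies to
      \<open>x {1}\<close>.\<close>
    have 1: "D 1 (y {}) = x {1}"
      using UD[of "x {1}"] mem[OF x] by (simp add: ys lin DU k1[symmetric])
    have 2: "D 2 (y {}) = x {2}"
      using UD[of "x {2}"] mem[OF x] by (simp add: ys lin DU k1)
    have 3: "D 2 (y {1}) \<ominus> D 1 (y {2}) = x UNIV"
      using UD[of "x UNIV"] mem[OF x]
      by (simp add: ys lin DU diff_eq_scale scale_scale a_comm)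
    have "koszul_boundary H D y S = x S" for S
    proof (cases S rule: set_two_cases)
      case (2 i)
      then show ?thesis
        using bd[OF y] \<open>D 1 (y {}) = x {1}\<close> \<open>D 2 (y {}) = x {2}\<close> exhaust_2[of i] by auto
    qed (use bd[OF y] x0 3 in auto)
    then show ?thesis using y by (intro image_eqI[of _ _ y]) auto
  qed
  show ?thesis
    unfolding koszul_exact_def using closed complex exact by auto
qed

text \<open>Each \<open>T i\<close> is scalar on the whole space, so all shifted operators and hence
  the boundary map vanish. The constant family \<open>v\<close> is then a cycle but not a
  boundary.\<close>

lemma joint_eigenvector_in_taylor_spectrum:
  fixes \<mu> :: "complex^('n::{finite,linorder})"
  assumes v: "v \<in> carrier H" "v \<noteq> \<zero>"
    and T: "\<And>i x. x \<in> carrier H \<Longrightarrow> T i x = (\<mu> $ i) \<odot> x"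
  shows "\<mu> \<in> taylor_spectrum H T"
proof -
  let ?D = "\<lambda>i x. T i x \<ominus> (\<mu> $ i) \<odot> x"
  have zero: "koszul_boundary H ?D x S = \<zero>" if "x \<in> koszul_space H" for x S
    using that unfolding koszul_boundary_def
    by (intro add.finprod_one_eqI) (auto simp: koszul_space_def T Pi_iff)
  have v': "(\<lambda>_. v) \<in> koszul_space H"
    using v by (auto simp: koszul_space_def)
  show ?thesis unfolding taylor_spectrum_def
  proof (safe)
    assume "koszul_exact H ?D"
    then have "(\<lambda>_. v) \<in> koszul_boundary H ?D ` koszul_space H"
      using v' zero unfolding koszul_exact_def by blast
    then obtain x where "x \<in> koszul_space H" "(\<lambda>_. v) = koszul_boundary H ?D x"
      by blast
    then show False using zero[of x "{}"] v(2) by (metis (no_types))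
  qed
qed

subsection \<open>Inverses and powers\<close>

lemma op_inverse_eq:
  assumes "A \<in> carrier H \<rightarrow> carrier H" and "\<And>x. x \<in> carrier H \<Longrightarrow> B x \<in> carrier H"
    and "\<And>x. x \<in> carrier H \<Longrightarrow> B (A x) = x \<and> A (B x) = x"
    and "x \<in> carrier H"
  shows "op_inverse H A x = B x"
proof (rule inv_into_f_eq)
  show "inj_on A (carrier H)" using assms(3) by (metis inj_onI)
qed (use assms in auto)

text \<open>Serves \<open>op_inverse\<close>: the function \<open>inv_into\<close> and a given
  inverse may differ off the carrier.\<close>

lemma bounded_operator_cong:
  assumes "\<And>x. x \<in> carrier H \<Longrightarrow> A x = B x"
  shows "bounded_operator H A \<longleftrightarrow> bounded_operator H B"
  using assms unfolding bounded_operator_def by (simp add: Pi_iff)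

lemma op_inverse:
  assumes A: "invertible_operator H A"
  shows "bounded_operator H (op_inverse H A)"
    and "x \<in> carrier H \<Longrightarrow> A (op_inverse H A x) = x"
    and "x \<in> carrier H \<Longrightarrow> op_inverse H A (A x) = x"
proof -
  obtain B where B: "bounded_operator H B"
      "\<And>x. x \<in> carrier H \<Longrightarrow> B (A x) = x \<and> A (B x) = x"
    using A by (auto simp: invertible_operator_def)
  moreover have "A \<in> carrier H \<rightarrow> carrier H"
    using A by (auto simp: invertible_operator_def bounded_operator_def)
  moreover have "B x \<in> carrier H" if "x \<in> carrier H" for x
    using B(1) that by (auto simp: bounded_operator_def)
  ultimately have eq: "op_inverse H A x = B x" if "x \<in> carrier H" for x
    using that by (intro op_inverse_eq) auto
  show "bounded_operator H (op_inverse H A)"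
    using B(1) eq by (subst bounded_operator_cong) auto
  show "x \<in> carrier H \<Longrightarrow> A (op_inverse H A x) = x" using B(2) eq by simp
  have "A x \<in> carrier H" if "x \<in> carrier H" using \<open>A \<in> _\<close> that by auto
  then show "x \<in> carrier H \<Longrightarrow> op_inverse H A (A x) = x" using B(2) eq by simp
qed

text \<open>The powers nest, so the innermost product of \<open>A\<close> and \<open>B\<close>
  collapses to the scalar \<open>c\<close>, once for each of the \<open>k\<close> layers.\<close>

lemma funpow_product_scalar:
  assumes A: "linear_operator H A" and B: "linear_operator H B"
    and AB: "\<And>x. x \<in> carrier H \<Longrightarrow> A (B x) = c \<odot> x" and x: "x \<in> carrier H"
  shows "(A ^^ k) ((B ^^ k) x) = (c ^ k) \<odot> x"
proof (induction k)
  case 0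
  then show ?case using x by simp
next
  case (Suc k)
  note cl = funpow_closed[OF A] funpow_closed[OF B]
  have "(A ^^ Suc k) ((B ^^ Suc k) x) = (A ^^ k) (c \<odot> (B ^^ k) x)"
    using AB[OF cl(2)[OF x]] by (simp add: funpow_swap1)
  also have "\<dots> = c \<odot> (c ^ k \<odot> x)"
    using linear_operatorD(3)[OF linear_operator_funpow[OF A]] cl(2)[OF x] Suc by simp
  finally show ?case using x by (simp add: scale_scale)
qed

end

section \<open>Bounded rational functions on the hyperbola\<close>

text \<open>After multiplication by a common power of \<open>z $ 1\<close>, the denominator is a
  monomial by absence of zeros and the numerator a monomial of the same exponent by the bound. The
  two monomial identities are recorded as well, since they are what carries over to
  operators.\<close>

lemma hyperbola_rational_bounded:
  fixes c :: complex and p g :: "2 cpoly"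
  defines "Y \<equiv> {z :: complex^2. z $ 1 * z $ 2 = c}"
  assumes c: "c \<noteq> 0"
    and g: "\<And>z. z \<in> Y \<Longrightarrow> peval g z \<noteq> 0"
    and pg: "\<And>z. z \<in> Y \<Longrightarrow> cmod (peval p z) \<le> M * cmod (peval g z)"
  obtains N a k \<gamma> where "a \<noteq> 0"
    and "\<And>m. m \<in> Poly_Mapping.keys p \<union> Poly_Mapping.keys g \<Longrightarrow> Poly_Mapping.lookup m 2 \<le> N"
    and "hyperbola_poly c N g = Polynomial.monom a k"
    and "hyperbola_poly c N p = Polynomial.monom (\<gamma> * a) k"
    and "\<And>z. z \<in> Y \<Longrightarrow> peval p z = \<gamma> * peval g z"
proof -
  obtain N where N: "\<And>m. m \<in> Poly_Mapping.keys p \<union> Poly_Mapping.keys g \<Longrightarrow>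
      Poly_Mapping.lookup m 2 \<le> N"
    using finite_nat_set_iff_bounded_le[of
        "(\<lambda>m. Poly_Mapping.lookup m 2) ` (Poly_Mapping.keys p \<union> Poly_Mapping.keys g)"]
    by auto
  let ?P = "hyperbola_poly c N p" and ?G = "hyperbola_poly c N g"
  have P: "poly ?P (z $ 1) = (z $ 1) ^ N * peval p z"
    and G: "poly ?G (z $ 1) = (z $ 1) ^ N * peval g z" if "z \<in> Y" for z
    using that N by (auto intro!: poly_hyperbola_poly simp: Y_def)
  have param: "\<exists>\<xi>\<in>Y. \<xi> $ 1 = z" if "z \<noteq> 0" for z
    using that by (intro bexI[of _ "vector [z, c / z]"]) (auto simp: Y_def)
  have "poly ?G z \<noteq> 0" if "z \<noteq> 0" for z
    using param[OF that] G g that by fastforce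
  then obtain a k where a: "a \<noteq> 0" and Ga: "?G = Polynomial.monom a k"
    by (rule monom_if_zero_free_off_0)
  have "cmod (poly ?P z) \<le> (M * cmod a) * cmod z ^ k" if z: "z \<noteq> 0" for z
  proof -
    obtain \<xi> :: "complex^2" where \<xi>: "\<xi> \<in> Y" "\<xi> $ 1 = z" using param[OF z] by blast
    have "cmod (poly ?P z) = cmod z ^ N * cmod (peval p \<xi>)"
      using P[OF \<xi>(1)] \<xi>(2) by (simp add: norm_mult norm_power)
    also have "\<dots> \<le> cmod z ^ N * (M * cmod (peval g \<xi>))"
      by (intro mult_left_mono pg \<xi>) simp
    also have "\<dots> = M * cmod (poly ?G z)"
      using G[OF \<xi>(1)] \<xi>(2) by (simp add: norm_mult norm_power)
    finally show ?thesis by (simp add: Ga poly_monom norm_mult norm_power)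
  qed
  then obtain b where Pb: "?P = Polynomial.monom b k"
    by (rule monom_if_bounded_by_power)
  have "peval p z = (b / a) * peval g z" if z: "z \<in> Y" for z
  proof -
    \<comment> \<open>Here \<open>c \<noteq> 0\<close> enters; it allows the factor
      \<open>(z $ 1) ^ N\<close> to be cancelled.\<close>
    have z0: "z $ 1 \<noteq> 0" using z c by (auto simp: Y_def)
    have "(z $ 1) ^ N * peval p z = b * (z $ 1) ^ k"
      and "(z $ 1) ^ N * peval g z = a * (z $ 1) ^ k"
      using P[OF z] G[OF z] by (simp_all add: Pb Ga poly_monom)
    then have "(z $ 1) ^ N * peval p z = (z $ 1) ^ N * (b / a * peval g z)"
      using a by (metis (no_types, lifting) mult.left_commute nonzero_mult_div_cancel_left
          times_divide_eq_left times_divide_eq_right)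
    then show ?thesis using z0 by (subst (asm) mult_cancel_left) simp
  qed
  then show thesis using that[of a N k "b / a"] a N Ga Pb by simp
qed

section \<open>Pairs of operators with scalar product\<close>

text \<open>What is retained of a pair in the image of \<open>kappa\<close>: two linear maps that
  are inverse to each other up to the nonzero scalar \<open>c\<close>.\<close>

locale hyperbola_pair = complex_hilbert_space H for H :: "('a, 'b) hilbert_scheme" (structure) +
  fixes T :: "2 \<Rightarrow> 'a \<Rightarrow> 'a" and c :: complex
  assumes linear_T: "linear_operator H (T i)"
    and T12: "x \<in> carrier H \<Longrightarrow> T 1 (T 2 x) = c \<odot> x"
    and T21: "x \<in> carrier H \<Longrightarrow> T 2 (T 1 x) = c \<odot> x"
    and c_nonzero: "c \<noteq> 0"
begin

abbreviation hyperbola :: "(complex^2) set" where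
  "hyperbola \<equiv> {z. z $ 1 * z $ 2 = c}"

lemmas T_closed = linear_operatorD(1)[OF linear_T]
lemmas linear_T_funpow = linear_operator_funpow[OF linear_T]
lemmas T_funpow_closed = linear_operatorD(1)[OF linear_T_funpow]

lemma T_commute: "x \<in> carrier H \<Longrightarrow> T i (T j x) = T j (T i x)"
  using exhaust_2[of i] exhaust_2[of j] by (auto simp: T12 T21)

lemma taylor_spectrum_hyperbola: "taylor_spectrum H T \<subseteq> hyperbola"
proof (intro subsetI)
  fix \<mu> :: "complex^2" assume \<mu>: "\<mu> \<in> taylor_spectrum H T"
  show "\<mu> \<in> hyperbola"
  proof (rule ccontr)
    assume "\<mu> \<notin> hyperbola"
    then have d: "c - \<mu> $ 1 * \<mu> $ 2 \<noteq> 0" by simp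
    \<comment> \<open>The operators \<open>U\<close> are the coefficients \<open>T 2\<close> and
      \<open>\<mu> $ 1\<close> of the identity for \<open>c - \<mu> $ 1 * \<mu> $ 2\<close>; the
      factor \<open>d\<close> normalises its value to \<open>1\<close>.\<close>
    define d where "d = 1 / (c - \<mu> $ 1 * \<mu> $ 2)"
    define D where "D = (\<lambda>i x. T i x \<ominus> (\<mu> $ i) \<odot> x)"
    define U where "U = (\<lambda>i :: 2. if i = 1 then (\<lambda>x. d \<odot> T 2 x) else (\<lambda>x. (d * \<mu> $ 1) \<odot> x))"
    have D: "linear_operator H (D i)" for i
      unfolding D_def by (intro linear_operator_diff_scale linear_T)
    have id: "linear_operator H (\<lambda>x. x)"
      using bounded_operator_id by (simp add: bounded_operator_iff_linear)
    have U: "linear_operator H (U i)" for i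
      unfolding U_def
      using linear_operator_scale[OF linear_T] linear_operator_scale[OF id] by simp
    have DT: "D i (T j x) = T j (D i x)" if "x \<in> carrier H" for i j x
      unfolding D_def by (intro diff_scale_commute linear_T T_commute that)
    have DD: "D 1 (D 2 x) = D 2 (D 1 x)" if x: "x \<in> carrier H" for x
    proof -
      have "D 2 (D 1 x) = T 2 (D 1 x) \<ominus> (\<mu> $ 2) \<odot> D 1 x" by (simp add: D_def)
      also have "\<dots> = D 1 (T 2 x \<ominus> (\<mu> $ 2) \<odot> x)"
        using DT[OF x] T_closed x
        by (simp add: diff_scale_commute[OF linear_T D] linear_operatorD[OF D] DT
            diff_eq_scale)
      finally show ?thesis by (simp add: D_def)
    qed
    have "D i (U j x) = U j (D i x)" if x: "x \<in> carrier H" for i j x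
      using x T_closed by (simp add: U_def linear_operatorD[OF D] DT)
    moreover have "U 1 (D 1 x) \<oplus> U 2 (D 2 x) = x" if x: "x \<in> carrier H" for x
    proof -
      have "U 1 (D 1 x) = (d * c) \<odot> x \<oplus> (- (d * \<mu> $ 1)) \<odot> T 2 x"
        using x T_closed
        by (simp add: U_def D_def diff_eq_scale linear_operatorD[OF linear_T] T21
            scale_add_right scale_scale)
      moreover have "U 2 (D 2 x) = (d * \<mu> $ 1) \<odot> T 2 x \<oplus> (- (d * \<mu> $ 1 * \<mu> $ 2)) \<odot> x"
        using x T_closed
        by (simp add: U_def D_def diff_eq_scale scale_add_right scale_scale mult.assoc)
      \<comment> \<open>The mixed terms in \<open>T 2 x\<close> cancel.\<close>
      moreover have "(- (d * \<mu> $ 1)) \<odot> T 2 x \<oplus> ((d * \<mu> $ 1) \<odot> T 2 x \<oplus> y) = y"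
        if "y \<in> carrier H" for y
        using x T_closed that by (simp add: scale_add_left[symmetric] a_assoc[symmetric])
      ultimately have "U 1 (D 1 x) \<oplus> U 2 (D 2 x)
          = (d * c) \<odot> x \<oplus> (- (d * \<mu> $ 1 * \<mu> $ 2)) \<odot> x"
        using x T_closed by (simp add: a_assoc)
      also have "\<dots> = (d * (c - \<mu> $ 1 * \<mu> $ 2)) \<odot> x"
        using x by (simp add: right_diff_distrib mult.assoc flip: scale_add_left)
      also have "\<dots> = x" using x d by (simp add: d_def)
      finally show ?thesis .
    qed
    ultimately have "koszul_exact H D"
      by (intro koszul_exact_two[OF D U DD])
    then show False using \<mu> by (simp add: taylor_spectrum_def D_def)
  qed
qed

text \<open>Up to the nonzero scalar \<open>c ^ n\<close>, \<open>T 2 ^^ n\<close> is a left inverse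
  of \<open>T 1 ^^ n\<close>. Hence vector equations may be checked after applying a power of
  \<open>T 1\<close>.\<close>

lemma funpow_T1_cancel:
  assumes "x \<in> carrier H" and "y \<in> carrier H" and eq: "(T 1 ^^ n) x = (T 1 ^^ n) y"
  shows "x = y"
proof -
  have "c ^ n \<odot> x = c ^ n \<odot> y"
    using funpow_product_scalar[OF linear_T linear_T T21, of _ n] assms by metis
  then have "(1 / c ^ n) \<odot> (c ^ n \<odot> x) = (1 / c ^ n) \<odot> (c ^ n \<odot> y)" by simp
  then show ?thesis using assms c_nonzero by (simp add: scale_scale)
qed

lemma op_monomial_closed: "x \<in> carrier H \<Longrightarrow> op_monomial T m x \<in> carrier H"
  by (simp add: op_monomial_two T_funpow_closed)

lemma op_peval_closed: "x \<in> carrier H \<Longrightarrow> op_peval H p T x \<in> carrier H"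
  unfolding op_peval_def by (intro finsum_closed) (auto simp: op_monomial_closed)

text \<open>The operator counterpart of \<open>poly_hyperbola_poly\<close>: a high enough power of
  \<open>T 1\<close> absorbs every \<open>T 2\<close> and leaves a polynomial in \<open>T 1\<close>
  alone.\<close>

lemma funpow_op_peval:
  assumes N: "\<And>m. m \<in> Poly_Mapping.keys p \<Longrightarrow> Poly_Mapping.lookup m 2 \<le> N"
    and x: "x \<in> carrier H"
  shows "(T 1 ^^ N) (op_peval H p T x) = poly_apply (T 1) x (hyperbola_poly c N p)"
proof -
  have monomial: "(T 1 ^^ N) (op_monomial T m x) =
      c ^ Poly_Mapping.lookup m 2 \<odot>
        (T 1 ^^ (Poly_Mapping.lookup m 1 + N - Poly_Mapping.lookup m 2)) x"
    if m: "m \<in> Poly_Mapping.keys p" for m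
  proof -
    let ?k = "Poly_Mapping.lookup m 2" and ?l = "Poly_Mapping.lookup m 1"
    \<comment> \<open>The innermost \<open>?k\<close> factors of \<open>T 1 ^^ N\<close> meet the
      \<open>?k\<close> factors of \<open>T 2\<close>; the bound on the exponents ensures that there
      are enough of them.\<close>
    obtain j where j: "N = j + ?k" using N[OF m] le_Suc_ex[of ?k N] by (auto simp: add.commute)
    have "(T 1 ^^ N) (op_monomial T m x)
        = (T 1 ^^ j) ((T 1 ^^ ?k) ((T 2 ^^ ?k) ((T 1 ^^ ?l) x)))"
      by (subst j) (simp add: op_monomial_two funpow_add)
    also have "\<dots> = (T 1 ^^ j) (c ^ ?k \<odot> (T 1 ^^ ?l) x)"
      using funpow_product_scalar[OF linear_T linear_T T12] T_funpow_closed[OF x] by simp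
    also have "\<dots> = c ^ ?k \<odot> (T 1 ^^ (?l + N - ?k)) x"
      using linear_operatorD(3)[OF linear_T_funpow] T_funpow_closed[OF x] j
      by (simp add: funpow_add flip: add.commute[of j])
    finally show ?thesis .
  qed
  have "(T 1 ^^ N) (op_peval H p T x) = (\<Oplus>m\<in>Poly_Mapping.keys p.
      (T 1 ^^ N) (Poly_Mapping.lookup p m \<odot> op_monomial T m x))"
    unfolding op_peval_def using x
    by (intro linear_operator_finsum linear_T_funpow) (auto simp: op_monomial_closed)
  also have "\<dots> = (\<Oplus>m\<in>Poly_Mapping.keys p. poly_apply (T 1) x
      (Polynomial.monom (Poly_Mapping.lookup p m * c ^ Poly_Mapping.lookup m 2)
        (Poly_Mapping.lookup m 1 + N - Poly_Mapping.lookup m 2)))"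
    using x
    by (intro finsum_cong')
      (auto simp: poly_apply_monom[OF linear_T] T_funpow_closed monomial scale_scale
        linear_operatorD(3)[OF linear_T_funpow] op_monomial_closed)
  also have "\<dots> = poly_apply (T 1) x (hyperbola_poly c N p)"
    unfolding hyperbola_poly_def by (intro poly_apply_sum[OF linear_T x, symmetric]) simp
  finally show ?thesis .
qed

text \<open>Multiplied by \<open>T 1 ^^ N\<close>, numerator and denominator become proportional
  monomials in \<open>T 1\<close> with ratio \<gamma>. Cancelling that power gives \<gamma> as the
  value of the quotient, on points and on operators alike.\<close>

lemma rational_bounded_on_hyperbola:
  assumes g: "\<And>z. z \<in> hyperbola \<Longrightarrow> peval g z \<noteq> 0"
    and pg: "\<And>z. z \<in> hyperbola \<Longrightarrow> cmod (peval p z) \<le> M * cmod (peval g z)"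
  obtains \<gamma> where "\<And>z. z \<in> hyperbola \<Longrightarrow> peval p z = \<gamma> * peval g z"
    and "\<And>x. x \<in> carrier H \<Longrightarrow>
      op_peval H p T (op_inverse H (op_peval H g T) x) = \<gamma> \<odot> x"
proof -
  obtain N a k \<gamma> where a: "a \<noteq> 0"
    and N: "\<And>m. m \<in> Poly_Mapping.keys p \<union> Poly_Mapping.keys g \<Longrightarrow> Poly_Mapping.lookup m 2 \<le> N"
    and G: "hyperbola_poly c N g = Polynomial.monom a k"
    and P: "hyperbola_poly c N p = Polynomial.monom (\<gamma> * a) k"
    and \<gamma>: "\<And>z. z \<in> hyperbola \<Longrightarrow> peval p z = \<gamma> * peval g z"
    by (rule hyperbola_rational_bounded[OF c_nonzero, of g p M]) (use g pg in auto)
  let ?g = "op_peval H g T" and ?p = "op_peval H p T"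
  have g_power: "(T 1 ^^ N) (?g x) = a \<odot> (T 1 ^^ k) x"
    and p_power: "(T 1 ^^ N) (?p x) = (\<gamma> * a) \<odot> (T 1 ^^ k) x" if "x \<in> carrier H" for x
    using that N by (simp_all add: funpow_op_peval G P poly_apply_monom[OF linear_T])
  have pg: "?p x = \<gamma> \<odot> ?g x" if x: "x \<in> carrier H" for x
  proof (rule funpow_T1_cancel[of _ _ N])
    show "(T 1 ^^ N) (?p x) = (T 1 ^^ N) (\<gamma> \<odot> ?g x)"
      using x by (simp add: p_power g_power linear_operatorD(3)[OF linear_T_funpow]
          op_peval_closed scale_scale T_funpow_closed)
  qed (use x op_peval_closed in auto)
  \<comment> \<open>For a surjective map \<open>inv_into\<close> returns genuine preimages. The
    witness \<open>x\<close> solves \<open>a\<close> times \<open>(T 1 ^^ k) x\<close> equals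
    \<open>(T 1 ^^ N) y\<close>, with \<open>T 2 ^^ k\<close> undoing \<open>T 1 ^^ k\<close> up to
    \<open>c ^ k\<close>.\<close>
  have surj: "y \<in> ?g ` carrier H" if y: "y \<in> carrier H" for y
  proof
    define x where "x = (1 / (a * c ^ k)) \<odot> (T 2 ^^ k) ((T 1 ^^ N) y)"
    show x: "x \<in> carrier H" using y by (simp add: x_def T_funpow_closed)
    have "(T 1 ^^ N) (?g x) = a \<odot> ((1 / (a * c ^ k)) \<odot> (c ^ k \<odot> (T 1 ^^ N) y))"
      using y x funpow_product_scalar[OF linear_T linear_T T12]
      by (simp add: g_power) (simp add: x_def linear_operatorD(3)[OF linear_T_funpow] T_funpow_closed)
    also have "\<dots> = (T 1 ^^ N) y"
      using y a c_nonzero by (simp add: scale_scale T_funpow_closed)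
    finally show "y = ?g x"
      using x y by (intro funpow_T1_cancel[of "?g x" y N, symmetric] op_peval_closed)
  qed
  have "?p (op_inverse H ?g y) = \<gamma> \<odot> y" if y: "y \<in> carrier H" for y
    using pg[OF inv_into_into[OF surj[OF y]]] f_inv_into_f[OF surj[OF y]] by simp
  with \<gamma> that show thesis by blast
qed

lemma von_Neumann_set_hyperbola: "von_Neumann_set hyperbola H T"
  unfolding von_Neumann_set_def
proof (intro conjI allI impI taylor_spectrum_hyperbola)
  fix p g :: "2 cpoly"
  assume g: "\<forall>\<xi>\<in>hyperbola. peval g \<xi> \<noteq> 0"
  define S where "S = (SUP \<xi>\<in>hyperbola. ennreal (cmod (peval p \<xi> / peval g \<xi>)))"
  show "op_norm H (op_peval H p T \<circ> op_inverse H (op_peval H g T)) \<le> S"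
  \<comment> \<open>An infinite supremum leaves nothing to prove; a finite one bounds the quotient
    on the hyperbola.\<close>
  proof (cases "S = \<infinity>")
    case False
    have "cmod (peval p \<xi>) \<le> enn2real S * cmod (peval g \<xi>)" if \<xi>: "\<xi> \<in> hyperbola" for \<xi>
    proof -
      have "ennreal (cmod (peval p \<xi> / peval g \<xi>)) \<le> S"
        unfolding S_def by (intro SUP_upper \<xi>)
      also have "S = ennreal (enn2real S)" using False by (simp add: less_top)
      finally have "cmod (peval p \<xi> / peval g \<xi>) \<le> enn2real S" by simp
      then show ?thesis using g \<xi> by (simp add: norm_divide divide_simps)
    qed
    note bound = this
    obtain \<gamma> where \<gamma>: "\<And>z. z \<in> hyperbola \<Longrightarrow> peval p z = \<gamma> * peval g z"
      and op: "\<And>x. x \<in> carrier H \<Longrightarrow>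
        op_peval H p T (op_inverse H (op_peval H g T) x) = \<gamma> \<odot> x"
      by (rule rational_bounded_on_hyperbola[of g p "enn2real S"]) (use g bound in auto)
    \<comment> \<open>Any point of the hyperbola shows that the modulus of \<gamma> is at most the
      supremum; this one is explicit.\<close>
    have pt: "vector [1, c] \<in> hyperbola" by simp
    have "ennreal (cmod \<gamma>) \<le> S"
      unfolding S_def using pt \<gamma>[OF pt] g by (intro SUP_upper2[OF pt]) auto
    moreover have "cmod \<gamma> * hnorm H x \<le> cmod \<gamma>" if "hnorm H x \<le> 1" for x
      using that by (simp add: mult_left_le)
    ultimately show ?thesis
      unfolding op_norm_def
      by (intro SUP_least) (auto simp: op hnorm_scale intro: order_trans[OF ennreal_leI])
  qed simp
qed

end

section \<open>Images under \<open>kappa\<close> as hyperbola pairs\<close>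

lemma kappa_hyperbola_pair:
  assumes "complex_hilbert_space H" and A: "invertible_operator H A" and "0 < r"
  shows "hyperbola_pair H (snd (kappa r (H, A))) (complex_of_real (r / (1 + r\<^sup>2)))"
    and "commuting_tuple H (snd (kappa r (H, A)))"
proof -
  interpret complex_hilbert_space H by fact
  let ?T = "snd (kappa r (H, A))" and ?c = "complex_of_real (r / (1 + r\<^sup>2))"
  have A_bounded: "bounded_operator H A"
    using A by (simp add: invertible_operator_def)
  have bounded: "bounded_operator H (?T i)" for i
    using bounded_operator_scale[OF A_bounded] bounded_operator_scale[OF op_inverse(1)[OF A]]
    by (simp add: kappa_def)
  have lin: "linear_operator H A" "linear_operator H (op_inverse H A)"
    using A_bounded op_inverse(1)[OF A] by (simp_all add: bounded_operator_iff_linear)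
  \<comment> \<open>\<open>A\<close> cancels against its inverse in either order, so only the
    product of the two scalar factors survives.\<close>
  have c: "complex_of_real (1 / sqrt (1 + r\<^sup>2)) * complex_of_real (r / sqrt (1 + r\<^sup>2)) = ?c"
    by (simp flip: of_real_mult)
  show pair: "hyperbola_pair H ?T ?c"
  proof
    show "linear_operator H (?T i)" for i
      using bounded by (simp add: bounded_operator_iff_linear)
    have "0 < r / (1 + r\<^sup>2)" using \<open>0 < r\<close> by (simp add: add_pos_nonneg)
    then show "?c \<noteq> 0" by (metis less_irrefl of_real_eq_0_iff)
    show "?T 1 (?T 2 x) = ?c \<odot>\<^bsub>H\<^esub> x" if "x \<in> carrier H" for x
      using that unfolding c[symmetric]
      by (simp add: kappa_def linear_operatorD[OF lin(1)] linear_operatorD[OF lin(2)]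
          op_inverse[OF A] scale_scale)
    show "?T 2 (?T 1 x) = ?c \<odot>\<^bsub>H\<^esub> x" if "x \<in> carrier H" for x
      using that unfolding c[symmetric]
      by (simp add: kappa_def linear_operatorD[OF lin(1)] linear_operatorD[OF lin(2)]
          op_inverse[OF A] scale_scale mult.commute)
  qed
  show "commuting_tuple H ?T"
    unfolding commuting_tuple_def
    using bounded hyperbola_pair.T_commute[OF pair] by blast
qed

section \<open>Scalar operators\<close>

text \<open>The one-dimensional space of complex numbers, transported along \<open>e\<close> into
  the universe type; \<open>inv_into UNIV e\<close> decodes a vector.\<close>

definition scalar_hilbert :: "(complex \<Rightarrow> 'a) \<Rightarrow> 'a hilbert" where
  "scalar_hilbert e = \<lparr>carrier = range e,
     monoid.mult = (\<lambda>x y. e (inv_into UNIV e x * inv_into UNIV e y)), one = e 1, ring.zero = e 0,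
     add = (\<lambda>x y. e (inv_into UNIV e x + inv_into UNIV e y)), smult = (\<lambda>c x. e (c * inv_into UNIV e x)),
     cinner = (\<lambda>x y. inv_into UNIV e x * cnj (inv_into UNIV e y))\<rparr>"

lemma scalar_hilbert_simps:
  assumes "inj e"
  shows "carrier (scalar_hilbert e) = range e"
    and "\<zero>\<^bsub>scalar_hilbert e\<^esub> = e 0"
    and "e a \<oplus>\<^bsub>scalar_hilbert e\<^esub> e b = e (a + b)"
    and "c \<odot>\<^bsub>scalar_hilbert e\<^esub> e a = e (c * a)"
    and "cinner (scalar_hilbert e) (e a) (e b) = a * cnj b"
    and "hnorm (scalar_hilbert e) (e a) = cmod a"
  using assms by (simp_all add: scalar_hilbert_def hnorm_def cmod_def power2_eq_square)

lemma complex_hilbert_space_scalar_hilbert: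
  assumes e: "inj e"
  shows "complex_hilbert_space (scalar_hilbert e)"
proof -
  let ?H = "scalar_hilbert e"
  note simps = scalar_hilbert_simps[OF e] ring_of_type_algebra_simps
  have ag: "abelian_group ?H"
  proof (rule abelian_groupI)
    fix x assume "x \<in> carrier ?H"
    then obtain a where "x = e a" by (auto simp: simps)
    then show "\<exists>y\<in>carrier ?H. y \<oplus>\<^bsub>?H\<^esub> x = \<zero>\<^bsub>?H\<^esub>"
      by (intro bexI[of _ "e (- a)"]) (auto simp: simps)
  qed (auto simp: simps add_ac)
  interpret module "ring_of_type_algebra :: complex ring" ?H
    by (rule moduleI[OF cring_from_type_algebra ag]) (auto simp: simps algebra_simps)
  have minus: "e a \<ominus>\<^bsub>?H\<^esub> e b = e (a - b)" for a b
    using minus_equality[of "e (- b)" "e b"] by (simp add: a_minus_def simps)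
  show ?thesis
  proof
    fix u :: "nat \<Rightarrow> 'a"
    assume u: "\<And>n. u n \<in> carrier ?H"
      and cauchy: "\<And>\<epsilon>. 0 < \<epsilon> \<Longrightarrow>
        \<exists>N. \<forall>m\<ge>N. \<forall>n\<ge>N. hnorm ?H (u m \<ominus>\<^bsub>?H\<^esub> u n) < \<epsilon>"
    from u have "\<exists>v. \<forall>n. u n = e (v n)"
      by (intro choice) (auto simp: simps)
    then obtain v where v: "\<And>n. u n = e (v n)" by blast
    \<comment> \<open>Completeness is inherited from the complex numbers through the decoded
      sequence \<open>v\<close>.\<close>
    have "Cauchy v"
      using cauchy by (simp add: Cauchy_def v minus simps dist_norm)
    then obtain l where "v \<longlonglongrightarrow> l"
      using Cauchy_convergent_iff convergent_def by blast
    then have "(\<lambda>n. cmod (v n - l)) \<longlonglongrightarrow> 0"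
      by (simp add: LIM_zero tendsto_norm_zero)
    then show "\<exists>x\<in>carrier ?H. (\<lambda>n. hnorm ?H (u n \<ominus>\<^bsub>?H\<^esub> x)) \<longlonglongrightarrow> 0"
      by (intro bexI[of _ "e l"]) (auto simp: v minus simps)
  next
    fix x assume "x \<in> carrier ?H" "x \<noteq> \<zero>\<^bsub>?H\<^esub>"
    then obtain a where "x = e a" "a \<noteq> 0" by (auto simp: simps)
    then show "0 < Re (cinner ?H x x)"
      by (simp add: simps complex_neq_0 flip: power2_eq_square)
  qed (auto simp: simps algebra_simps)
qed

text \<open>Multiplication by \<open>\<xi> $ 1 * s\<close> on a one-dimensional space works:
  \<open>kappa\<close> divides it by \<open>s\<close> and so returns multiplication by the two
  coordinates of \<xi>.\<close>

lemma hyperbola_point_in_spectrum: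
  fixes \<xi> :: "complex^2" and e :: "complex \<Rightarrow> 'a"
  assumes r: "0 < r" and e: "inj e" and \<xi>: "\<xi> $ 1 * \<xi> $ 2 = complex_of_real (r / (1 + r\<^sup>2))"
  obtains H :: "'a hilbert" and A where "(H, A) \<in> C_beta"
    and "\<xi> \<in> taylor_spectrum H (snd (kappa r (H, A)))"
proof -
  let ?H = "scalar_hilbert e"
  interpret complex_hilbert_space ?H
    by (rule complex_hilbert_space_scalar_hilbert[OF e])
  define s where "s = complex_of_real (sqrt (1 + r\<^sup>2))"
  have "0 < 1 + r\<^sup>2" by (simp add: add_pos_nonneg)
  then have s: "s \<noteq> 0" "s * s = complex_of_real (1 + r\<^sup>2)"
    unfolding s_def by (simp, simp only: of_real_mult[symmetric], simp)
  \<comment> \<open>The second coordinate is rewritten into the form in which \<open>kappa\<close>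
    produces it from the inverse of \<open>\<xi> $ 1 * s\<close>.\<close>
  have \<xi>2: "\<xi> $ 1 \<noteq> 0" "\<xi> $ 2 = (complex_of_real r / s) * (1 / (\<xi> $ 1 * s))"
  proof -
    have "0 < r / (1 + r\<^sup>2)" using r \<open>0 < 1 + r\<^sup>2\<close> by simp
    then show \<xi>1: "\<xi> $ 1 \<noteq> 0"
      using \<xi> by (metis less_irrefl mult_zero_left of_real_eq_0_iff)
    have "\<xi> $ 1 * \<xi> $ 2 = complex_of_real r / (s * s)"
      by (simp only: \<xi> s of_real_divide)
    then show "\<xi> $ 2 = (complex_of_real r / s) * (1 / (\<xi> $ 1 * s))"
      using \<xi>1 s(1) by (simp add: field_simps)
  qed
  define A where "A = (\<lambda>x. (\<xi> $ 1 * s) \<odot>\<^bsub>?H\<^esub> x)"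
  define B where "B = (\<lambda>x. (1 / (\<xi> $ 1 * s)) \<odot>\<^bsub>?H\<^esub> x)"
  have bounded: "bounded_operator ?H A" "bounded_operator ?H B"
    unfolding A_def B_def by (intro bounded_operator_scale bounded_operator_id)+
  have AB: "B (A x) = x \<and> A (B x) = x" if "x \<in> carrier ?H" for x
    using that \<xi>2(1) s(1) by (simp add: A_def B_def scale_scale)
  have mem: "(?H, A) \<in> C_beta"
    using bounded AB complex_hilbert_space_scalar_hilbert[OF e]
    by (auto simp: C_beta_def invertible_operator_def)
  have inv: "op_inverse ?H A x = B x" if "x \<in> carrier ?H" for x
    using that AB by (intro op_inverse_eq) (auto simp: A_def B_def)
  have "snd (kappa r (?H, A)) i x = (\<xi> $ i) \<odot>\<^bsub>?H\<^esub> x" if x: "x \<in> carrier ?H" for i x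
  proof (cases "i = 1")
    case True
    then show ?thesis
      using x s(1) by (simp add: kappa_def A_def scale_scale of_real_divide flip: s_def)
  next
    case False
    then have "i = 2" using exhaust_2[of i] by auto
    then show ?thesis
      using x by (simp add: kappa_def inv B_def scale_scale of_real_divide \<xi>2(2) flip: s_def)
  qed
  moreover have "e 1 \<in> carrier ?H" "e 1 \<noteq> \<zero>\<^bsub>?H\<^esub>"
    using e by (auto simp: scalar_hilbert_simps[OF e] inj_eq)
  ultimately have "\<xi> \<in> taylor_spectrum ?H (snd (kappa r (?H, A)))"
    by (intro joint_eigenvector_in_taylor_spectrum[of "e 1"])
  with mem show thesis by (rule that)
qed

text \<open>The injection \<open>e\<close> provides the one-dimensional space on which the scalar
  operators for minimality act.\<close>

theorem theorem5p15:
  fixes r :: real and e :: "complex \<Rightarrow> 'a" and q :: "2 cpoly"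
  assumes "0 < r" and "r < 1" and "inj e"
  defines "q \<equiv> pvar 1 * pvar 2 - pconst (complex_of_real (r / (1 + r\<^sup>2)))"
  shows "minimal_closed_von_Neumann_set (zero_set q)
           (kappa r ` (C_beta :: ('a hilbert \<times> ('a \<Rightarrow> 'a)) set))"
proof -
  let ?Y = "{z :: complex^2. z $ 1 * z $ 2 = complex_of_real (r / (1 + r\<^sup>2))}"
  have Y: "zero_set q = ?Y" unfolding q_def by (rule zero_set_hyperbola)
  have kappa: "kappa r HA = (fst HA, snd (kappa r HA))" for HA :: "'a hilbert \<times> ('a \<Rightarrow> 'a)"
    by (cases HA) (simp add: kappa_def)
  have members: "complex_hilbert_space H \<and> commuting_tuple H T \<and> von_Neumann_set ?Y H T"
    if "(H, T) \<in> kappa r ` C_beta" for H :: "'a hilbert" and T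
  proof -
    from that obtain A where HA: "(H, A) \<in> C_beta" "T = snd (kappa r (H, A))"
      by (auto simp: kappa_def)
    then have H: "complex_hilbert_space H" "invertible_operator H A"
      by (auto simp: C_beta_def)
    show ?thesis
      unfolding HA(2)
      using H(1) kappa_hyperbola_pair[OF H \<open>0 < r\<close>]
        hyperbola_pair.von_Neumann_set_hyperbola[OF kappa_hyperbola_pair(1)[OF H \<open>0 < r\<close>]]
      by blast
  qed
  have "closed ?Y"
    by (intro closed_Collect_eq continuous_intros)
  moreover have "\<exists>(H, T)\<in>kappa r ` (C_beta :: ('a hilbert \<times> ('a \<Rightarrow> 'a)) set).
      \<not> von_Neumann_set Y1 H T" if "Y1 \<subset> ?Y" for Y1
  proof -
    \<comment> \<open>A point missing from \<open>Y1\<close> lies in the Taylor spectrum of some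
      member, so the spectral inclusion already fails.\<close>
    from that obtain \<xi> where \<xi>: "\<xi> \<in> ?Y" "\<xi> \<notin> Y1" by blast
    obtain H :: "'a hilbert" and A where HA: "(H, A) \<in> C_beta"
      "\<xi> \<in> taylor_spectrum H (snd (kappa r (H, A)))"
      using \<xi>(1) by (auto intro: hyperbola_point_in_spectrum[OF \<open>0 < r\<close> \<open>inj e\<close>])
    then have "\<not> von_Neumann_set Y1 H (snd (kappa r (H, A)))"
      using \<xi>(2) by (auto simp: von_Neumann_set_def)
    moreover have "(H, snd (kappa r (H, A))) \<in> kappa r ` C_beta"
      using HA(1) kappa[of "(H, A)"] by (metis fst_conv imageI)
    ultimately show ?thesis by blast
  qed
  ultimately show ?thesis
    unfolding minimal_closed_von_Neumann_set_def Y using members by blast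
qed

end
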